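(* For every non-decreasing function $\delta\colon(0,1)\to(0,1)$ there exist a surjective and four-valent analytic map $\psi\colon\mathbb{D}\to\mathbb{D}$ and $0<h_0<1$ such that for all $0<h\le h_0$, $$m\big(\{z\in\mathbb{T}\,;\ |\psi^*(z)|\ge1-h\}\big)\le\delta(h).$$
   Context: $\mathbb{D}$ is the open unit disk, $\mathbb{T}=\partial\mathbb{D}$, $m$ the normalized Lebesgue measure on $\mathbb{T}$, and $\psi^*(\xi)=\lim_{r\to1^-}\psi(r\xi)$ is the a.e. defined radial limit. Four-valent means every point has at most four preimages. *)

theory Defs
  imports "HOL-Analysis.Analysis"
begin

definition has_radial_limit :: "(complex \<Rightarrow> complex) \<Rightarrow> complex \<Rightarrow> complex \<Rightarrow> bool" where
  "has_radial_limit \<psi> \<xi> L \<longleftrightarrow> ((\<lambda>r::real. \<psi> (of_real r * \<xi>)) \<longlongrightarrow> L) (at_left 1)"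

definition radial_level_set :: "(complex \<Rightarrow> complex) \<Rightarrow> real \<Rightarrow> real set" where
  "radial_level_set \<psi> h =
     {t \<in> {0..<2*pi}. \<exists>L. has_radial_limit \<psi> (cis t) L \<and> norm L \<ge> 1 - h}"

text \<open>Normalized Lebesgue measure on the unit circle, via the parametrization t -> exp(it).\<close>
definition circle_measure :: "real set \<Rightarrow> real" where
  "circle_measure S = measure lebesgue S / (2*pi)"

definition at_most_four_valent :: "(complex \<Rightarrow> complex) \<Rightarrow> complex set \<Rightarrow> bool" where
  "at_most_four_valent f A \<longleftrightarrow> (\<forall>w. finite {z \<in> A. f z = w} \<and> card {z \<in> A. f z = w} \<le> 4)"

end

theory Submission
  imports Defs "HOL-Complex_Analysis.Riemann_Mapping"
begin

text \<open>
  Let \<^term>\<open>f\<close> map the disc conformally onto the strip between the graphs of \<^term>\<open>g\<close> and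
  \<^term>\<open>g + 4 * pi\<close> over the positive half-line. Then \<^term>\<open>exp (- f)\<close> covers the punctured disc and
  is at most two-valent, and composing with a Blaschke product of degree two that vanishes at 0 and
  at 1/2 fills in the origin and doubles the valence. Where the composition has modulus close to 1, the
  real part of \<^term>\<open>f\<close> is small, so its imaginary part exceeds a value of \<^term>\<open>g\<close> that can be
  prescribed as large as we please. Since \<^term>\<open>f\<close> takes values in the right half-plane, the real part of
  its square root is a positive harmonic function comparable to the square root of its modulus; the
  mean value property and Markov's inequality therefore bound the measure of the set where
  \<^term>\<open>f\<close> is at least M in modulus by a constant times the inverse square root of M, and the
  constant depends only on the value of \<^term>\<open>f\<close> at the origin, hence not on \<^term>\<open>g\<close>.
\<close>

section \<open>Mean value property and the measure estimate\<close>

text \<open>Cauchy's formula at the centre of the circle: the kernel 1/u cancels the speed of the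
  parametrisation up to the factor \<open>\<i>\<close>.\<close>

lemma circle_mean_value:
  fixes f :: "complex \<Rightarrow> complex"
  assumes "f holomorphic_on ball 0 1" "0 < r" "r < 1"
  shows "((\<lambda>t. f (of_real r * cis t)) has_integral 2 * pi * f 0) {0..2*pi}"
proof -
  have "((\<lambda>u. f u / (u - 0)) has_contour_integral (2 * of_real pi * \<i> * f 0)) (circlepath 0 r)"
    by (rule Cauchy_integral_circlepath_simple)
       (use assms in \<open>auto intro: holomorphic_on_subset\<close>)
  then have "((\<lambda>t. f (0 + of_real r * cis t) / (0 + of_real r * cis t - 0) * of_real r * \<i> * cis t)
      has_integral (2 * of_real pi * \<i> * f 0)) {0..2*pi}"
    unfolding circlepath_def by (subst (asm) has_contour_integral_part_circlepath_iff) auto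
  then have "((\<lambda>t. f (of_real r * cis t) * \<i>) has_integral (2 * of_real pi * \<i> * f 0)) {0..2*pi}"
    using assms by (simp add: field_simps)
  from has_integral_mult_left[OF this, of "-\<i>"] show ?thesis
    by (simp add: mult.assoc) (simp add: mult.commute mult.left_commute)
qed

text \<open>For s = x + i y the hypothesis reads y^2 < x^2, while the norm of the square is x^2 +
  y^2.\<close>

lemma norm_power2_le_Re:
  assumes "0 < Re (s\<^sup>2)"
  shows "norm (s\<^sup>2) \<le> 2 * (Re s)\<^sup>2"
  using assms by (simp add: norm_power cmod_power2 Re_power2)

lemma norm_le_Re_csqrt:
  assumes "0 < Re w"
  shows "norm w \<le> 2 * (Re (csqrt w))\<^sup>2"
  using norm_power2_le_Re[of "csqrt w"] assms unfolding power2_csqrt by blast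

lemma continuous_on_circle:
  assumes "continuous_on (ball 0 1) f" "\<bar>r\<bar> < 1"
  shows "continuous_on UNIV (\<lambda>t. f (of_real r * cis t))"
  by (rule continuous_on_compose2[OF assms(1)])
     (use assms(2) in \<open>auto intro!: continuous_intros simp: norm_mult\<close>)

text \<open>Markov's inequality for \<open>u\<close>, whose mean over the circle is
  \<open>Re (csqrt (f 0))\<close> and which is at least \<open>sqrt (M/2)\<close> on
  \<open>S\<close>. The bound does not depend on \<open>r\<close>, so it survives the passage to the
  boundary.\<close>

lemma measure_circle_large_le:
  assumes hol: "f holomorphic_on ball 0 1" and pos: "\<And>z. z \<in> ball 0 1 \<Longrightarrow> 0 < Re (f z)"
    and r: "0 < r" "r < 1" and "0 < M"
    and S: "S \<in> sets lebesgue" "S \<subseteq> {0..2*pi}"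
    and large: "\<And>t. t \<in> S \<Longrightarrow> M \<le> norm (f (of_real r * cis t))"
  shows "S \<in> lmeasurable" "measure lebesgue S \<le> 2 * pi * sqrt (2 * norm (f 0) / M)"
proof -
  show Sm: "S \<in> lmeasurable"
    by (rule fmeasurableI2[of "{0..2*pi}"]) (use S in auto)
  define u where "u t = Re (csqrt (f (of_real r * cis t)))" for t
  have mem: "of_real r * cis t \<in> ball 0 1" for t
    using r by (simp add: norm_mult)
  have "(\<lambda>z. csqrt (f z)) holomorphic_on ball 0 1"
    using hol by (rule holomorphic_on_csqrt') (use pos in \<open>fastforce simp: complex_nonpos_Reals_iff\<close>)
  from circle_mean_value[OF this r]
  have "(u has_integral Re (2 * pi * csqrt (f 0))) {0..2*pi}"
    unfolding u_def by (rule has_integral_Re)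
  then have I: "((\<lambda>t. if t \<in> {0..2*pi} then u t else 0) has_integral 2 * pi * Re (csqrt (f 0))) UNIV"
    by (subst has_integral_restrict_UNIV) simp
  have J: "((\<lambda>t. sqrt (M/2) * indicator S t) has_integral sqrt (M/2) * measure lebesgue S) UNIV"
    using Sm by (intro has_integral_mult_right) (simp add: lmeasurable_iff_has_integral)
  have "sqrt (M/2) * indicator S t \<le> (if t \<in> {0..2*pi} then u t else 0)" for t
  proof (cases "t \<in> S")
    case True
    have "norm (f (of_real r * cis t)) \<le> 2 * (u t)\<^sup>2"
      unfolding u_def by (intro norm_le_Re_csqrt pos mem)
    with large[OF True] have "M/2 \<le> (u t)\<^sup>2" by simp
    moreover have "0 \<le> u t" unfolding u_def by (rule Re_csqrt)
    ultimately have "sqrt (M/2) \<le> u t" by (simp add: real_le_lsqrt)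
    then show ?thesis using True S by auto
  next
    case False
    then show ?thesis using Re_csqrt by (simp add: u_def del: csqrt.simps)
  qed
  then have "sqrt (M/2) * measure lebesgue S \<le> 2 * pi * Re (csqrt (f 0))"
    by (intro has_integral_le[OF J I]) auto
  also have "\<dots> \<le> 2 * pi * sqrt (norm (f 0))"
    using complex_Re_le_cmod[of "csqrt (f 0)"] by simp
  finally have "measure lebesgue S \<le> 2 * pi * sqrt (norm (f 0)) / sqrt (M/2)"
    using \<open>0 < M\<close> by (simp add: field_simps)
  then show "measure lebesgue S \<le> 2 * pi * sqrt (2 * norm (f 0) / M)"
    by (simp add: real_sqrt_divide real_sqrt_mult ac_simps)
qed

text \<open>Countably many tails replace the filter, which turns eventual statements into countable
  unions. The offset 2 keeps every tail at or above 1/2, hence away from the radius 0.\<close>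

lemma eventually_at_left_1_iff:
  "eventually P (at_left (1::real)) \<longleftrightarrow> (\<exists>n::nat. \<forall>r\<in>{1 - 1 / (real n + 2)..<1}. P r)"
proof
  assume "eventually P (at_left (1::real))"
  then obtain b where b: "b < 1" "\<And>r. b < r \<Longrightarrow> r < 1 \<Longrightarrow> P r"
    by (auto simp: eventually_at_left_field)
  obtain n :: nat where n: "1 / (1 - b) < n"
    using reals_Archimedean2 by blast
  have "1 / (real n + 2) < 1 - b"
    using n b(1) by (simp add: field_simps)
  then show "\<exists>n::nat. \<forall>r\<in>{1 - 1 / (real n + 2)..<1}. P r"
    by (intro exI[of _ n] ballI b(2)) auto
next
  assume "\<exists>n::nat. \<forall>r\<in>{1 - 1 / (real n + 2)..<1}. P r"
  then obtain n :: nat where "\<forall>r\<in>{1 - 1 / (real n + 2)..<1}. P r" by blast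
  then show "eventually P (at_left (1::real))"
    unfolding eventually_at_left_field
    by (intro exI[of _ "1 - 1 / (real n + 2)"]) auto
qed

lemma tail_radius_bounds:
  assumes "r \<in> {1 - 1 / (real n + 2)..<1}"
  shows "0 < r" "r < 1" "\<bar>r\<bar> < 1"
proof -
  have "1 / 2 \<le> 1 - 1 / (real n + 2)" by (simp add: field_simps)
  also have "\<dots> \<le> r" using assms by simp
  finally show "0 < r" "r < 1" "\<bar>r\<bar> < 1" using assms by auto
qed

text \<open>The points where the bound holds on the whole n-th tail form an increasing sequence of
  closed sets \<open>T n\<close> covering \<open>S\<close>. Each obeys the estimate for a single
  radius, always with the same constant, so continuity of measure from below carries it to the
  union.\<close>

lemma measure_eventually_large_le:
  assumes hol: "f holomorphic_on ball 0 1" and pos: "\<And>z. z \<in> ball 0 1 \<Longrightarrow> 0 < Re (f z)"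
    and "0 < M" and S: "S \<in> sets lebesgue" "S \<subseteq> {0..2*pi}"
    and large: "\<And>t. t \<in> S \<Longrightarrow> eventually (\<lambda>r. M \<le> norm (f (of_real r * cis t))) (at_left 1)"
  shows "measure lebesgue S \<le> 2 * pi * sqrt (2 * norm (f 0) / M)"
proof -
  define I where "I n = {1 - 1 / (real n + 2)..<1}" for n :: nat
  define T where "T n = {0..2*pi} \<inter> (\<Inter>r\<in>I n. {t. M \<le> norm (f (of_real r * cis t))})" for n
  have cont: "continuous_on (ball 0 1) f"
    using hol by (rule holomorphic_on_imp_continuous_on)
  have "closed (T n)" for n
    unfolding T_def I_def
    by (intro closed_Int closed_INT ballI closed_Collect_le continuous_on_norm
          continuous_on_circle[OF cont] tail_radius_bounds(3) closed_atLeastAtMost continuous_on_const)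
  then have Tl: "T n \<in> sets lebesgue" for n by (simp add: borel_closed)
  have mem: "1 - 1 / (real n + 2) \<in> I n" for n by (simp add: I_def)
  have T: "T n \<in> lmeasurable" "measure lebesgue (T n) \<le> 2 * pi * sqrt (2 * norm (f 0) / M)" for n
  proof -
    have "T n \<subseteq> {0..2*pi}" by (simp add: T_def)
    moreover have "M \<le> norm (f (of_real (1 - 1 / (real n + 2)) * cis t))" if "t \<in> T n" for t
      using that mem[of n] unfolding T_def by blast
    ultimately show "T n \<in> lmeasurable" "measure lebesgue (T n) \<le> 2 * pi * sqrt (2 * norm (f 0) / M)"
      using measure_circle_large_le[OF hol pos tail_radius_bounds(1,2)[OF mem[of n, unfolded I_def]]
          \<open>0 < M\<close> Tl, of n] by simp_all
  qed
  have mono: "T n \<subseteq> T (Suc n)" for n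
  proof -
    have "I (Suc n) \<subseteq> I n"
      unfolding I_def by (auto simp: field_simps)
    then show ?thesis unfolding T_def by blast
  qed
  have U: "(\<Union>n. T n) \<in> lmeasurable"
    by (rule measurable_nested_Union) (rule T mono)+
  have lim: "(\<lambda>n. measure lebesgue (T n)) \<longlonglongrightarrow> measure lebesgue (\<Union>n. T n)"
    by (rule measure_nested_Union) (rule T mono)+
  have "S \<subseteq> (\<Union>n. T n)"
  proof
    fix t assume "t \<in> S"
    then show "t \<in> (\<Union>n. T n)"
      using large[of t] S(2) unfolding eventually_at_left_1_iff T_def I_def by auto
  qed
  then have "measure lebesgue S \<le> measure lebesgue (\<Union>n. T n)"
    by (intro measure_mono_fmeasurable S U)
  also have "\<dots> \<le> 2 * pi * sqrt (2 * norm (f 0) / M)"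
    using lim by (rule LIMSEQ_le_const2) (use T in auto)
  finally show ?thesis .
qed

section \<open>Measurability of the radial level sets\<close>

text \<open>For fixed k and n the inner set is closed, being an intersection of closed sets, although r
  and s range over uncountable sets.\<close>

lemma radial_level_set_Cauchy:
  "radial_level_set \<psi> h = {0..<2*pi} \<inter> (\<Inter>k::nat. \<Union>n::nat.
     \<Inter>r\<in>{1 - 1 / (real n + 2)..<1}. \<Inter>s\<in>{1 - 1 / (real n + 2)..<1}.
       {t. norm (\<psi> (of_real r * cis t) - \<psi> (of_real s * cis t)) \<le> 1 / (real k + 1)} \<inter>
       {t. 1 - h - 1 / (real k + 1) \<le> norm (\<psi> (of_real r * cis t))})" (is "?L = ?R")
proof
  show "?L \<subseteq> ?R"
  proof
    fix t assume "t \<in> ?L"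
    then obtain L where t: "t \<in> {0..<2*pi}" and L: "1 - h \<le> norm L"
      and lim: "((\<lambda>r::real. \<psi> (of_real r * cis t)) \<longlongrightarrow> L) (at_left 1)"
      by (auto simp: radial_level_set_def has_radial_limit_def)
    have ex: "\<exists>n::nat. \<forall>r\<in>{1 - 1 / (real n + 2)..<1}. \<forall>s\<in>{1 - 1 / (real n + 2)..<1}.
       norm (\<psi> (of_real r * cis t) - \<psi> (of_real s * cis t)) \<le> 1 / (real k + 1) \<and>
       1 - h - 1 / (real k + 1) \<le> norm (\<psi> (of_real r * cis t))" for k :: nat
    proof -
      define e where "e = 1 / (real k + 1)"
      have "0 < e" by (simp add: e_def)
      then have "eventually (\<lambda>r. dist (\<psi> (of_real r * cis t)) L < e / 2) (at_left 1)"
        by (intro tendstoD[OF lim]) simp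
      then obtain n :: nat where n: "\<And>r. r \<in> {1 - 1 / (real n + 2)..<1} \<Longrightarrow>
          norm (\<psi> (of_real r * cis t) - L) < e / 2"
        unfolding eventually_at_left_1_iff dist_norm by blast
      show ?thesis
        unfolding e_def[symmetric]
      proof (intro exI[of _ n] ballI conjI)
        fix r s assume rs: "r \<in> {1 - 1 / (real n + 2)..<1}" "s \<in> {1 - 1 / (real n + 2)..<1}"
        show "norm (\<psi> (of_real r * cis t) - \<psi> (of_real s * cis t)) \<le> e"
          using norm_triangle_ineq4[of "\<psi> (of_real r * cis t) - L" "\<psi> (of_real s * cis t) - L"]
            n[OF rs(1)] n[OF rs(2)] by simp
        show "1 - h - e \<le> norm (\<psi> (of_real r * cis t))"
          using norm_triangle_ineq2[of L "\<psi> (of_real r * cis t)"] n[OF rs(1)] \<open>0 < e\<close> L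
          unfolding norm_minus_commute[of L] by linarith
      qed
    qed
    show "t \<in> ?R"
      unfolding Int_iff INT_iff UN_iff mem_Collect_eq ball_UNIV bex_UNIV
      by (intro conjI allI t ex)
  qed
  show "?R \<subseteq> ?L"
  proof
    fix t assume "t \<in> ?R"
    then have t: "t \<in> {0..<2*pi}" and ex: "\<exists>n::nat. \<forall>r\<in>{1 - 1 / (real n + 2)..<1}. \<forall>s\<in>{1 - 1 / (real n + 2)..<1}.
       norm (\<psi> (of_real r * cis t) - \<psi> (of_real s * cis t)) \<le> 1 / (real k + 1) \<and>
       1 - h - 1 / (real k + 1) \<le> norm (\<psi> (of_real r * cis t))" for k :: nat
      unfolding Int_iff INT_iff UN_iff mem_Collect_eq ball_UNIV bex_UNIV by simp_all
    define p where "p = (\<lambda>r::real. \<psi> (of_real r * cis t))"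
    \<comment> \<open>No limit is named in \<open>?R\<close>; it has to be produced by completeness
      from the Cauchy property along the filter.\<close>
    have "cauchy_filter (filtermap p (at_left 1))"
      unfolding cauchy_filter_metric_filtermap
    proof (intro allI impI)
      fix e :: real assume "0 < e"
      then obtain k :: nat where k: "1 / (real k + 1) < e"
        using reals_Archimedean[of e] by (auto simp: field_simps inverse_eq_divide)
      obtain n :: nat where n: "\<forall>r\<in>{1 - 1 / (real n + 2)..<1}. \<forall>s\<in>{1 - 1 / (real n + 2)..<1}.
         norm (p r - p s) \<le> 1 / (real k + 1)"
        using ex[of k] unfolding p_def by blast
      show "\<exists>P. eventually P (at_left 1) \<and> (\<forall>x y. P x \<and> P y \<longrightarrow> dist (p x) (p y) < e)"
      proof (intro exI[of _ "\<lambda>r. r \<in> {1 - 1 / (real n + 2)..<1}"] conjI allI impI)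
        show "eventually (\<lambda>r. r \<in> {1 - 1 / (real n + 2)..<1}) (at_left 1)"
          unfolding eventually_at_left_1_iff by blast
        fix x y assume "x \<in> {1 - 1 / (real n + 2)..<1} \<and> y \<in> {1 - 1 / (real n + 2)..<1}"
        then have "dist (p x) (p y) \<le> 1 / (real k + 1)"
          unfolding dist_norm using n by blast
        with k show "dist (p x) (p y) < e" by (rule le_less_trans[rotated])
      qed
    qed
    moreover have "filtermap p (at_left 1) \<noteq> bot" by (simp add: filtermap_bot_iff)
    ultimately obtain L where "filtermap p (at_left 1) \<le> nhds L"
      using complete_UNIV[where 'a = complex] unfolding complete_uniform by auto
    then have lim: "(p \<longlongrightarrow> L) (at_left 1)" by (simp add: filterlim_def)
    \<comment> \<open>Each k loses 1/(k+1) in the bound for the limit; letting k grow removes the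
      loss.\<close>
    have "1 - h - 1 / (real k + 1) \<le> norm L" for k :: nat
    proof (rule tendsto_lowerbound)
      show "((\<lambda>r. norm (p r)) \<longlongrightarrow> norm L) (at_left 1)"
        using lim by (rule tendsto_norm)
      show "eventually (\<lambda>r. 1 - h - 1 / (real k + 1) \<le> norm (p r)) (at_left 1)"
        using ex[of k] unfolding eventually_at_left_1_iff p_def by blast
    qed simp
    moreover have "(\<lambda>k. 1 - h - 1 / (real k + 1)) \<longlonglongrightarrow> 1 - h - 0"
      by (intro tendsto_diff tendsto_const)
         (use LIMSEQ_inverse_real_of_nat in \<open>simp add: inverse_eq_divide add.commute\<close>)
    ultimately have "1 - h \<le> norm L"
      by (intro LIMSEQ_le_const2[of "\<lambda>k. 1 - h - 1 / (real k + 1)"]) auto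
    with t lim show "t \<in> ?L"
      by (auto simp: radial_level_set_def has_radial_limit_def p_def)
  qed
qed

lemma radial_level_set_borel:
  assumes "continuous_on (ball 0 1) \<psi>"
  shows "radial_level_set \<psi> h \<in> sets borel"
proof -
  define C where "C k n = (\<Inter>r\<in>{1 - 1 / (real n + 2)..<1}. \<Inter>s\<in>{1 - 1 / (real n + 2)..<1}.
       {t. norm (\<psi> (of_real r * cis t) - \<psi> (of_real s * cis t)) \<le> 1 / (real k + 1)} \<inter>
       {t. 1 - h - 1 / (real k + 1) \<le> norm (\<psi> (of_real r * cis t))})" for k n :: nat
  have "closed (C k n)" for k n
    unfolding C_def
    by (intro closed_Int closed_INT ballI closed_Collect_le continuous_intros
          continuous_on_circle[OF assms] tail_radius_bounds(3))
  then have "range (C k) \<subseteq> sets borel" for k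
    by (auto intro: borel_closed)
  then have "(\<Union>n. C k n) \<in> sets borel" for k
    by (rule sets.countable_UN)
  then have "(\<Inter>k. \<Union>n. C k n) \<in> sets borel"
    by (intro sets.countable_INT) auto
  moreover have "radial_level_set \<psi> h = {0..<2*pi} \<inter> (\<Inter>k. \<Union>n. C k n)"
    unfolding C_def by (rule radial_level_set_Cauchy)
  ultimately show ?thesis by simp
qed

section \<open>Continuous majorant of a decreasing function\<close>

lemma continuous_majorant_exists:
  fixes G :: "real \<Rightarrow> real"
  assumes anti: "antimono_on {0<..<1} G" and pos: "\<And>s. s \<in> {0<..<1} \<Longrightarrow> 0 \<le> G s"
  obtains g :: "real \<Rightarrow> real"
  where "continuous_on {0<..} g" "g 1 = 0" "\<And>x. 0 < x \<Longrightarrow> x \<le> 1/2 \<Longrightarrow> G x \<le> g x"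
proof -
  \<comment> \<open>g x is (2/x) times the integral of G over the interval from x/2 to 1/2, whose part up to x
    already contributes at least G x.\<close>
  define F where "F u = integral {min u (1/2)..1/2} G" for u
  have int: "G integrable_on {a..1/2}" if "0 < a" for a
  proof -
    have "mono_on {a..1/2} (\<lambda>s. - G s)"
      using anti that by (auto simp: monotone_on_def)
    then have "(\<lambda>s. - G s) integrable_on {a..1/2}" by (rule integrable_on_mono_on)
    from integrable_neg[OF this] show ?thesis by simp
  qed
  have contF: "continuous_on {a..} F" if "0 < a" "a \<le> 1/2" for a
  proof -
    have "continuous_on {a..1/2} (\<lambda>x. integral {x..1/2} G)"
      by (rule indefinite_integral_continuous_1'[OF int[OF that(1)]])
    then show ?thesis unfolding F_def
      by (rule continuous_on_compose2[where f = "\<lambda>u. min u (1/2)"])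
         (use that in \<open>auto intro!: continuous_intros\<close>)
  qed
  \<comment> \<open>Continuity at x follows from continuity on a closed half-line starting strictly
    below x; the cap at 1/2 keeps its start in the range of \<open>contF\<close>.\<close>
  have contF0: "continuous_on {0<..} F"
  proof (rule continuous_at_imp_continuous_on, rule ballI)
    fix x :: real assume "x \<in> {0<..}"
    then show "isCont F x"
      using continuous_on_interior[OF contF[of "min (x/2) (1/2)"], of x] by (simp add: min_def split: if_splits)
  qed
  show ?thesis
  proof
    show "continuous_on {0<..} (\<lambda>x. 2 / x * F (x/2))"
      by (intro continuous_intros continuous_on_compose2[OF contF0]) auto
    \<comment> \<open>The interval of integration degenerates here, which pins the value of the
      majorant at 1 for every \<open>G\<close>.\<close>
    show "2 / 1 * F (1/2) = 0" by (simp add: F_def)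
    fix x :: real assume x: "0 < x" "x \<le> 1/2"
    have "x / 2 * G x = integral {x/2..x} (\<lambda>_. G x)" using x by simp
    also have "\<dots> \<le> integral {x/2..x} G"
      by (rule integral_le)
         (use x anti int[of "x/2"] in \<open>auto simp: monotone_on_def intro: integrable_on_subinterval\<close>)
    also have "\<dots> \<le> F (x/2)"
      unfolding F_def
      by (rule integral_subset_le)
         (use x pos int[of "x/2"] in \<open>auto intro: integrable_on_subinterval\<close>)
    finally show "G x \<le> 2 / x * F (x/2)" using x by (simp add: field_simps)
  qed
qed

section \<open>The strip and its Riemann map\<close>

text \<open>The height 4 pi is two periods of exp: an open interval of this length meets every class
  modulo 2 pi, and in at most two points. An open interval of one period would miss the class of its
  endpoints.\<close>

definition winding_strip :: "(real \<Rightarrow> real) \<Rightarrow> complex set" where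
  "winding_strip g = {z. 0 < Re z \<and> g (Re z) < Im z \<and> Im z < g (Re z) + 4 * pi}"

text \<open>The vertical shear \<open>h\<close> straightens the strip: it maps the convex half-strip
  \<open>S\<close> homeomorphically onto it, with inverse \<open>k\<close>.\<close>

lemma winding_strip_simply_connected:
  assumes g: "continuous_on {0<..} g"
  shows "open (winding_strip g)" "simply_connected (winding_strip g)"
proof -
  define h where "h z = z + \<i> * of_real (g (Re z))" for z
  define k where "k z = z - \<i> * of_real (g (Re z))" for z
  define S where "S = {z. 0 < Re z} \<inter> {z. 0 < Im z} \<inter> {z. Im z < 4 * pi}"
  have gRe: "continuous_on A (\<lambda>z. g (Re z))" if "A \<subseteq> {z. 0 < Re z}" for A
    by (rule continuous_on_compose2[OF g]) (use that in \<open>auto intro!: continuous_intros\<close>)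
  have cont: "continuous_on A h" "continuous_on A k" if "A \<subseteq> {z. 0 < Re z}" for A
    unfolding h_def k_def by (intro continuous_intros gRe that)+
  have "convex S"
    unfolding S_def
    by (intro convex_Int convex_halfspace_Re_gt convex_halfspace_Im_gt convex_halfspace_Im_lt)
  then have "simply_connected S" by (rule convex_imp_simply_connected)
  moreover have "homeomorphism S (winding_strip g) h k"
  proof (rule homeomorphismI)
    show "continuous_on S h" "continuous_on (winding_strip g) k"
      by (intro cont; auto simp: S_def winding_strip_def)+
  qed (auto simp: S_def winding_strip_def h_def k_def complex_eq_iff)
  ultimately show "simply_connected (winding_strip g)"
    using homeomorphic_simply_connected homeomorphic_def by blast
  have "winding_strip g = {z. 0 < Re z} \<inter> k -` S"
    by (auto simp: S_def winding_strip_def k_def)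
  moreover have "open ({z. 0 < Re z} \<inter> k -` S)"
    unfolding S_def
    by (rule continuous_open_preimage[OF cont(2)])
       (auto intro!: open_Int open_halfspace_Re_gt open_halfspace_Im_gt open_halfspace_Im_lt)
  ultimately show "open (winding_strip g)" by simp
qed

text \<open>The Riemann map \<open>G\<close> is precomposed with a disc automorphism
  \<open>q\<close> taking 0 to \<open>F a\<close>. Prescribing the value at 0 keeps the constant of
  the measure estimate under control.\<close>

lemma Riemann_map_at:
  assumes "open S" "simply_connected S" "S \<noteq> UNIV" "a \<in> S"
  obtains f where "f holomorphic_on ball 0 1" "bij_betw f (ball 0 1) S" "f 0 = a"
proof -
  obtain F G where F: "\<And>z. z \<in> S \<Longrightarrow> F z \<in> ball 0 1 \<and> G (F z) = z"
    and G: "G holomorphic_on ball 0 1" "\<And>z. z \<in> ball 0 1 \<Longrightarrow> G z \<in> S \<and> F (G z) = z"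
    using Riemann_mapping_theorem[of S] assms by blast
  obtain p q where p: "p (F a) = 0" "p ` ball 0 1 \<subseteq> ball 0 1"
    and q: "q holomorphic_on ball 0 1" "q ` ball 0 1 \<subseteq> ball 0 1"
    and pq: "\<And>z. z \<in> ball 0 1 \<Longrightarrow> p (q z) = z" "\<And>z. z \<in> ball 0 1 \<Longrightarrow> q (p z) = z"
    using ball_biholomorphism_exists F[OF \<open>a \<in> S\<close>] by metis
  show ?thesis
  proof
    show "(G \<circ> q) holomorphic_on ball 0 1"
      using q(1) G(1) q(2) by (rule holomorphic_on_compose_gen)
    show "bij_betw (G \<circ> q) (ball 0 1) S"
      by (rule bij_betw_byWitness[where f' = "p \<circ> F"])
         (use F G p q pq in \<open>auto simp: image_subset_iff\<close>)
    show "(G \<circ> q) 0 = a"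
      using F[OF \<open>a \<in> S\<close>] p(1) pq(2)[of "F a"] by simp
  qed
qed

section \<open>Fibres, and the exponential on the strip\<close>

lemma card_le_2I:
  assumes "\<And>x y z. x \<in> S \<Longrightarrow> y \<in> S \<Longrightarrow> z \<in> S \<Longrightarrow> x = y \<or> y = z \<or> x = z"
  shows "finite S \<and> card S \<le> 2"
proof -
  obtain x y where "S \<subseteq> {x, y}" using assms by (cases "S = {}") blast+
  then show ?thesis
    using card_mono[of "{x,y}" S] finite_subset[of S "{x,y}"] by (auto simp: card_insert_if split: if_splits)
qed

text \<open>Valences multiply: the fibre of the composite is the union of the inner fibres over the
  points of the outer fibre.\<close>

lemma card_fibre_compose_le:
  assumes "f ` A \<subseteq> B"
    and "\<And>v. finite {x\<in>A. f x = v} \<and> card {x\<in>A. f x = v} \<le> m"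
    and "finite {y\<in>B. g y = w} \<and> card {y\<in>B. g y = w} \<le> n"
  shows "finite {x\<in>A. g (f x) = w} \<and> card {x\<in>A. g (f x) = w} \<le> n * m"
proof -
  have eq: "{x\<in>A. g (f x) = w} = (\<Union>y\<in>{y\<in>B. g y = w}. {x\<in>A. f x = y})"
    using assms(1) by auto
  have "card {x\<in>A. g (f x) = w} \<le> (\<Sum>y\<in>{y\<in>B. g y = w}. card {x\<in>A. f x = y})"
    unfolding eq by (rule card_UN_le) (use assms(3) in blast)
  also have "\<dots> \<le> card {y\<in>B. g y = w} * m"
    using sum_bounded_above[of "{y\<in>B. g y = w}" "\<lambda>y. card {x\<in>A. f x = y}" m] assms(2) by simp
  also have "\<dots> \<le> n * m" using assms(3) by simp
  finally show ?thesis using assms(2,3) unfolding eq by simp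
qed

lemma exp_uminus_winding_strip:
  "(\<lambda>z. exp (- z)) ` winding_strip g = ball 0 1 - {0}"
proof
  show "(\<lambda>z. exp (- z)) ` winding_strip g \<subseteq> ball 0 1 - {0}"
    by (auto simp: winding_strip_def)
  show "ball 0 1 - {0} \<subseteq> (\<lambda>z. exp (- z)) ` winding_strip g"
  proof
    fix u :: complex assume u: "u \<in> ball 0 1 - {0}"
    define x where "x = - ln (norm u)"
    \<comment> \<open>The least integer that lifts the imaginary part strictly above
      \<open>g x\<close>; it then exceeds \<open>g x\<close> by at most 2 pi, well inside the
      strip.\<close>
    define k where "k = \<lfloor>(g x + Im (Ln u)) / (2 * pi)\<rfloor> + 1"
    define z where "z = - Ln u + \<i> * of_real (2 * pi * of_int k)"
    have "of_int k > (g x + Im (Ln u)) / (2 * pi)" "of_int k \<le> (g x + Im (Ln u)) / (2 * pi) + 1"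
      unfolding k_def by linarith+
    then have "2 * pi * of_int k > g x + Im (Ln u)" "2 * pi * of_int k \<le> g x + Im (Ln u) + 2 * pi"
      by (simp_all add: field_simps)
    moreover have "Re z = x" "0 < x" "Im z = 2 * pi * of_int k - Im (Ln u)"
      using u by (auto simp: z_def x_def)
    ultimately have "z \<in> winding_strip g"
      using pi_gt_zero unfolding winding_strip_def by auto
    moreover have "exp (- z) = exp (Ln u)"
      unfolding exp_eq by (intro exI[of _ "- k"]) (simp add: z_def algebra_simps)
    then have "exp (- z) = u" using u by simp
    ultimately show "u \<in> (\<lambda>z. exp (- z)) ` winding_strip g" by blast
  qed
qed

lemma exp_uminus_winding_strip_fibre:
  "finite {z \<in> winding_strip g. exp (- z) = u} \<and> card {z \<in> winding_strip g. exp (- z) = u} \<le> 2"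
proof (rule card_le_2I)
  fix x y z
  assume *: "x \<in> {z \<in> winding_strip g. exp (- z) = u}" "y \<in> {z \<in> winding_strip g. exp (- z) = u}"
    "z \<in> {z \<in> winding_strip g. exp (- z) = u}"
  \<comment> \<open>Points of one fibre share their real part, hence the same value of
    \<open>g\<close>, and their imaginary parts differ by a multiple of 2 pi smaller than 4
    pi.\<close>
  have step: "\<exists>n::int. -2 < n \<and> n < 2 \<and> b = a + of_int n * (2 * of_real pi * \<i>)"
    if "a \<in> {z \<in> winding_strip g. exp (- z) = u}" "b \<in> {z \<in> winding_strip g. exp (- z) = u}" for a b
  proof -
    have "exp (- a) = exp (- b)" using that by simp
    then obtain n :: int where n: "- a = - b + (of_int (2 * n) * of_real pi) * \<i>"
      unfolding exp_eq by auto
    then have "b = a + of_int n * (2 * of_real pi * \<i>)" by (simp add: algebra_simps)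
    moreover from this have "Re b = Re a" "Im b = Im a + of_int n * (2 * pi)" by auto
    moreover have "\<bar>Im b - Im a\<bar> < 4 * pi"
      using that \<open>Re b = Re a\<close> by (auto simp: winding_strip_def)
    ultimately have "\<bar>of_int n * (2 * pi)\<bar> < 2 * (2 * pi)" by simp
    then have "\<bar>of_int n :: real\<bar> < 2" by (simp add: abs_mult)
    then have "-2 < n" "n < 2" by linarith+
    with \<open>b = a + of_int n * (2 * of_real pi * \<i>)\<close> show ?thesis by blast
  qed
  obtain m n :: int where m: "-2 < m" "m < 2" "y = x + of_int m * (2 * of_real pi * \<i>)"
     and n: "-2 < n" "n < 2" "z = x + of_int n * (2 * of_real pi * \<i>)"
    using step[OF *(1,2)] step[OF *(1,3)] by auto
  obtain l :: int where l: "-2 < l" "l < 2" "z = y + of_int l * (2 * of_real pi * \<i>)"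
    using step[OF *(2,3)] by blast
  \<comment> \<open>All three shifts lie in {-1, 0, 1}. A sum of two nonzero ones is even, so
    \<open>m + l = n\<close> forces one of them to vanish.\<close>
  have "of_int (m + l) * (2 * of_real pi * \<i>) = of_int n * (2 * of_real pi * \<i>)"
    using m(3) n(3) l(3) by (simp add: algebra_simps)
  then have "m + l = n"
    by (subst (asm) mult_cancel_right) (simp only: of_int_eq_iff, simp)
  then have "m = 0 \<or> l = 0 \<or> n = 0" using m l n by presburger
  then show "x = y \<or> y = z \<or> x = z" using m n l by auto
qed

section \<open>The Blaschke product of degree two\<close>

text \<open>In \<open>Moebius_function 0 (1/2)\<close> the 0 is the angle of rotation and 1/2 the
  zero.\<close>

definition blaschke2 :: "complex \<Rightarrow> complex" where
  "blaschke2 w = w * Moebius_function 0 (1/2) w"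

lemma blaschke2_holomorphic: "blaschke2 holomorphic_on ball 0 1"
  unfolding blaschke2_def
  by (intro holomorphic_intros Moebius_function_holomorphic) (simp add: norm_divide)

lemma norm_blaschke2_le:
  assumes "norm w < 1"
  shows "norm (blaschke2 w) \<le> norm w"
proof -
  have "norm (Moebius_function 0 (1/2) w) < 1"
    by (rule Moebius_function_norm_lt_1) (use assms in \<open>auto simp: norm_divide\<close>)
  then show ?thesis
    unfolding blaschke2_def norm_mult by (simp add: mult_left_le)
qed

text \<open>Clearing the denominator 2 - w leaves a monic quadratic in w, from which both the size
  of the fibres and surjectivity are read off.\<close>

lemma blaschke2_eq_iff:
  assumes "norm w < 1"
  shows "blaschke2 w = v \<longleftrightarrow> w\<^sup>2 + (v - 1) / 2 * w - v = 0"
proof -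
  have "norm w < norm (2 :: complex)" using assms by simp
  then have "2 - w \<noteq> 0" by auto
  then have "blaschke2 w = w * (2 * w - 1) / (2 - w)"
    by (simp add: blaschke2_def Moebius_function_simple field_simps)
  then have "blaschke2 w = v \<longleftrightarrow> w * (2 * w - 1) = v * (2 - w)"
    using \<open>2 - w \<noteq> 0\<close> by (simp add: divide_eq_eq)
  also have "\<dots> \<longleftrightarrow> w\<^sup>2 + (v - 1) / 2 * w - v = 0"
    by algebra
  finally show ?thesis .
qed

lemma blaschke2_fibre:
  "finite {w \<in> ball 0 1 - {0}. blaschke2 w = v} \<and> card {w \<in> ball 0 1 - {0}. blaschke2 w = v} \<le> 2"
proof (rule card_le_2I)
  fix x y z
  assume "x \<in> {w \<in> ball 0 1 - {0}. blaschke2 w = v}" "y \<in> {w \<in> ball 0 1 - {0}. blaschke2 w = v}"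
    "z \<in> {w \<in> ball 0 1 - {0}. blaschke2 w = v}"
  then have "x\<^sup>2 + (v - 1) / 2 * x - v = 0" "y\<^sup>2 + (v - 1) / 2 * y - v = 0" "z\<^sup>2 + (v - 1) / 2 * z - v = 0"
    using blaschke2_eq_iff by auto
  \<comment> \<open>The Vandermonde product: a monic quadratic has no three distinct roots.\<close>
  then have "(x - y) * (y - z) * (x - z) = 0" by algebra
  then show "x = y \<or> y = z \<or> x = z" by auto
qed

lemma blaschke2_punctured_disc: "blaschke2 ` (ball 0 1 - {0}) = ball 0 1"
proof
  show "blaschke2 ` (ball 0 1 - {0}) \<subseteq> ball 0 1"
    using norm_blaschke2_le by (force intro: le_less_trans)
  show "ball 0 1 \<subseteq> blaschke2 ` (ball 0 1 - {0})"
  proof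
    fix v :: complex assume v: "v \<in> ball 0 1"
    \<comment> \<open>The product of the two roots is - v, so one of them lies in the disc.\<close>
    have "\<exists>w. norm w < 1 \<and> w \<noteq> 0 \<and> w\<^sup>2 + (v - 1) / 2 * w - v = 0"
    proof (cases "v = 0")
      case True
      \<comment> \<open>Here the roots are 0 and 1/2, and only the second lies in the punctured
        disc.\<close>
      then show ?thesis by (intro exI[of _ "1/2"]) (simp add: power2_eq_square norm_divide)
    next
      case False
      define b where "b = (v - 1) / 2"
      define d where "d = csqrt (b\<^sup>2 + 4 * v)"
      define p where "p = (- b + d) / 2"
      define q where "q = (- b - d) / 2"
      have d2: "d\<^sup>2 = b\<^sup>2 + 4 * v" by (simp add: d_def)
      then have roots: "p\<^sup>2 + b * p - v = 0" "q\<^sup>2 + b * q - v = 0" and pq: "p * q = - v"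
        unfolding p_def q_def by (simp_all add: field_simps power2_eq_square)
      have "norm p * norm q < 1" using pq v by (metis mem_ball_0 norm_minus_cancel norm_mult)
      then have "norm p < 1 \<or> norm q < 1"
        using mult_mono[of 1 "norm p" 1 "norm q"] by linarith
      moreover have "p \<noteq> 0" "q \<noteq> 0" using pq False by auto
      ultimately show ?thesis using roots unfolding b_def by blast
    qed
    then show "v \<in> blaschke2 ` (ball 0 1 - {0})"
      using blaschke2_eq_iff by (metis DiffI image_eqI mem_ball_0 singletonD)
  qed
qed

section \<open>Construction of the map and its boundary estimate\<close>

theorem theorem3p1:
  fixes \<delta> :: "real \<Rightarrow> real"
  assumes "\<forall>h\<in>{0<..<1}. \<delta> h \<in> {0<..<1}"
    and "mono_on {0<..<1} \<delta>"
  shows "\<exists>\<psi> :: complex \<Rightarrow> complex. \<exists>h0::real.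
           \<psi> holomorphic_on ball 0 1 \<and> \<psi> ` ball 0 1 = ball 0 1 \<and>
           at_most_four_valent \<psi> (ball 0 1) \<and> 0 < h0 \<and> h0 < 1 \<and>
           (\<forall>h. 0 < h \<and> h \<le> h0 \<longrightarrow>
               radial_level_set \<psi> h \<in> sets lebesgue \<and>
               circle_measure (radial_level_set \<psi> h) \<le> \<delta> h)"
proof -
  \<comment> \<open>The midpoint of the strip above 1 once \<open>g 1 = 0\<close>. It is fixed
    before \<open>g\<close>, so \<open>G\<close> may be defined from its norm without
    circularity.\<close>
  define a where "a = Complex 1 (2 * pi)"
  \<comment> \<open>The argument s / 4 absorbs the loss in passing from h to the bound 4 h on the real part of f.\<close>
  define G where "G s = 2 * norm a / (\<delta> (s / 4))\<^sup>2" for s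
  have \<delta>_pos: "0 < \<delta> h" if "0 < h" "h < 1" for h using assms(1) that by auto
  have "a \<noteq> 0" by (simp add: a_def complex_eq_iff)
  have G_anti: "antimono_on {0<..<1} G"
  proof (rule monotone_onI)
    fix s t :: real assume st: "s \<in> {0<..<1}" "t \<in> {0<..<1}" "s \<le> t"
    then have "\<delta> (s / 4) \<le> \<delta> (t / 4)"
      by (intro mono_onD[OF assms(2)]) auto
    moreover have "0 < \<delta> (s / 4)" using st by (intro \<delta>_pos) auto
    ultimately show "G t \<le> G s"
      unfolding G_def by (intro divide_left_mono power_mono) auto
  qed
  obtain g where g: "continuous_on {0<..} g" "g 1 = 0"
      "\<And>x. 0 < x \<Longrightarrow> x \<le> 1/2 \<Longrightarrow> G x \<le> g x"
    using continuous_majorant_exists[OF G_anti] by (auto simp: G_def)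
  define \<Omega> where "\<Omega> = winding_strip g"
  \<comment> \<open>The omitted point 0 makes the strip a proper subset of the plane, as the Riemann
    mapping theorem requires.\<close>
  have "a \<in> \<Omega>" "0 \<notin> \<Omega>" using g(2) by (simp_all add: \<Omega>_def winding_strip_def a_def)
  then obtain f where f: "f holomorphic_on ball 0 1" "bij_betw f (ball 0 1) \<Omega>" "f 0 = a"
    using Riemann_map_at[of \<Omega> a] winding_strip_simply_connected[OF g(1)] unfolding \<Omega>_def by blast
  have f_in: "f z \<in> \<Omega>" if "z \<in> ball 0 1" for z using bij_betwE[OF f(2)] that by blast
  have Re_f: "0 < Re (f z)" if "z \<in> ball 0 1" for z
    using f_in[OF that] by (simp add: \<Omega>_def winding_strip_def)
  define \<psi> where "\<psi> z = blaschke2 (exp (- f z))" for z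
  have exp_f: "(\<lambda>z. exp (- f z)) ` ball 0 1 = ball 0 1 - {0}"
    using exp_uminus_winding_strip[of g]
    unfolding \<Omega>_def[symmetric] bij_betw_imp_surj_on[OF f(2), symmetric]
    by (simp only: image_image)
  have surj: "\<psi> ` ball 0 1 = ball 0 1"
    using blaschke2_punctured_disc unfolding exp_f[symmetric] \<psi>_def by (simp only: image_image)
  have hol: "\<psi> holomorphic_on ball 0 1"
  proof -
    have "(\<lambda>z. exp (- f z)) holomorphic_on ball 0 1" by (intro holomorphic_intros f)
    then have "(blaschke2 \<circ> (\<lambda>z. exp (- f z))) holomorphic_on ball 0 1"
      using blaschke2_holomorphic by (rule holomorphic_on_compose_gen) (use exp_f in blast)
    then show ?thesis by (simp add: \<psi>_def[abs_def] o_def)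
  qed
  have valent: "at_most_four_valent \<psi> (ball 0 1)"
    unfolding at_most_four_valent_def
  proof
    fix w
    have "finite {z \<in> ball 0 1. f z = v} \<and> card {z \<in> ball 0 1. f z = v} \<le> 1" for v
    proof -
      have "{z \<in> ball 0 1. f z = v} \<subseteq> {inv_into (ball 0 1) f v}"
        using inv_into_f_f[OF bij_betw_imp_inj_on[OF f(2)]] by auto
      then show ?thesis
        using card_mono[of "{inv_into (ball 0 1) f v}"] by (auto intro: finite_subset)
    qed
    then have "finite {z \<in> ball 0 1. exp (- f z) = u} \<and> card {z \<in> ball 0 1. exp (- f z) = u} \<le> 2 * 1" for u
      by (rule card_fibre_compose_le[where B = \<Omega>, rotated])
         (use exp_uminus_winding_strip_fibre f_in in \<open>auto simp: \<Omega>_def\<close>)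
    then have "finite {z \<in> ball 0 1. blaschke2 (exp (- f z)) = w} \<and>
        card {z \<in> ball 0 1. blaschke2 (exp (- f z)) = w} \<le> 2 * (2 * 1)"
      by (rule card_fibre_compose_le[where B = "ball 0 1 - {0}", rotated])
         (use exp_f blaschke2_fibre in auto)
    then show "finite {z \<in> ball 0 1. \<psi> z = w} \<and> card {z \<in> ball 0 1. \<psi> z = w} \<le> 4"
      by (simp add: \<psi>_def)
  qed
  \<comment> \<open>A radial limit of norm at least 1 - h gives only the weaker bound 1 - 2 h near
    the boundary, hence the factor 2. The bound 1/8 ensures that 4 h stays in the range up to 1/2
    where \<open>g\<close> majorizes \<open>G\<close>.\<close>
  have large: "G (4 * h) \<le> norm (f z)"
    if h: "0 < h" "h \<le> 1/8" and z: "z \<in> ball 0 1" and "1 - 2 * h < norm (\<psi> z)" for h z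
  proof -
    define x where "x = Re (f z)"
    have x: "0 < x" using Re_f[OF z] by (simp add: x_def)
    have "norm (\<psi> z) \<le> exp (- x)"
      using norm_blaschke2_le[of "exp (- f z)"] x by (simp add: \<psi>_def x_def)
    with that have "1 - 2 * h < exp (- x)" by simp
    \<comment> \<open>This linearizes the bound to x (1 - 2 h) < 2 h; since 1 - 2 h is at least 1/2,
      x is at most 4 h.\<close>
    moreover have "exp (- x) \<le> 1 / (1 + x)"
      using exp_ge_add_one_self[of x] x by (simp add: exp_minus field_simps)
    ultimately have "1 - 2 * h < 1 / (1 + x)" by linarith
    then have "(1 - 2 * h) * (1 + x) < 1" using x by (simp add: less_divide_eq)
    then have "x * (1 - 2 * h) < 2 * h" by (simp add: algebra_simps)
    moreover have "x * (1 / 2) \<le> x * (1 - 2 * h)" using x h by (intro mult_left_mono) auto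
    ultimately have x4: "x \<le> 4 * h" by simp
    have "G (4 * h) \<le> G x"
      using monotone_onD[OF G_anti, of x "4 * h"] x x4 h by auto
    also have "\<dots> \<le> g x" using x x4 h by (intro g(3)) auto
    also have "\<dots> \<le> Im (f z)"
      using f_in[OF z] by (simp add: \<Omega>_def winding_strip_def x_def)
    also have "\<dots> \<le> norm (f z)" using abs_Im_le_cmod[of "f z"] by linarith
    finally show ?thesis .
  qed
  have "radial_level_set \<psi> h \<in> sets lebesgue \<and> circle_measure (radial_level_set \<psi> h) \<le> \<delta> h"
    if h: "0 < h" "h \<le> 1/8" for h
  proof
    have "radial_level_set \<psi> h \<in> sets borel"
      using hol by (intro radial_level_set_borel holomorphic_on_imp_continuous_on)
    then show S: "radial_level_set \<psi> h \<in> sets lebesgue" by simp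
    have \<delta>h: "0 < \<delta> h" using h by (intro \<delta>_pos) auto
    have "measure lebesgue (radial_level_set \<psi> h) \<le> 2 * pi * sqrt (2 * norm (f 0) / G (4 * h))"
    proof (rule measure_eventually_large_le[OF f(1) Re_f _ S])
      show "0 < G (4 * h)" using \<delta>h \<open>a \<noteq> 0\<close> by (simp add: G_def)
      show "radial_level_set \<psi> h \<subseteq> {0..2*pi}" by (auto simp: radial_level_set_def)
      fix t assume "t \<in> radial_level_set \<psi> h"
      then obtain L where L: "((\<lambda>r::real. \<psi> (of_real r * cis t)) \<longlongrightarrow> L) (at_left 1)" "1 - h \<le> norm L"
        by (auto simp: radial_level_set_def has_radial_limit_def)
      have "eventually (\<lambda>r. 1 - 2 * h < norm (\<psi> (of_real r * cis t))) (at_left 1)"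
        using tendsto_norm[OF L(1)] by (rule order_tendstoD) (use L(2) h in linarith)
      moreover have "eventually (\<lambda>r::real. 0 < r \<and> r < 1) (at_left 1)"
        by (auto simp: eventually_at_left_field intro!: exI[of _ 0])
      ultimately show "eventually (\<lambda>r. G (4 * h) \<le> norm (f (of_real r * cis t))) (at_left 1)"
        by eventually_elim (use h in \<open>auto intro!: large simp: norm_mult\<close>)
    qed
    \<comment> \<open>The definition of \<open>G\<close> inverts the measure estimate, so the square
      root becomes exactly \<open>\<delta> h\<close>.\<close>
    also have "2 * norm (f 0) / G (4 * h) = (\<delta> h)\<^sup>2"
      using \<open>a \<noteq> 0\<close> by (simp add: G_def f(3))
    finally show "circle_measure (radial_level_set \<psi> h) \<le> \<delta> h"
      using \<delta>h by (simp add: circle_measure_def field_simps)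
  qed
  with hol surj valent show ?thesis
    by (intro exI[of _ \<psi>] exI[of _ "1/8"]) auto
qed

end
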